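(* Let $c,d\in\mathbb{R}\langle\langle\bar X\rangle\rangle$ be rational series with underlying finite alphabets $X_c,X_d\subset\bar X$, respectively. Then the quasi-shuffle product $e=c\circledast d\in\mathbb{R}\langle\langle\bar X\rangle\rangle$ is rational with underlying alphabet $X_e=X_c\cup X_d\cup[X_cX_d]\subset\bar X$.
   Context: Let $X=\{x_0,x_1,\ldots,x_m\}$ be a finite alphabet. The augmented alphabet $\bar X$ is the graded commutative semigroup obtained from $X$ by a commutative, associative bracket operation $[\cdot\,\cdot]$: it consists of the letters of $X$ together with all finitely iterated brackets $x_{i_1,\ldots,i_n}:=[[[x_{i_1}x_{i_2}]\cdots]x_{i_n}]$ (so $[x_ix_j]=x_{i,j}=x_{j,i}$, and letters of $\bar X$ correspond to nonempty finite multisets of indices from $\{0,\ldots,m\}$). $\bar X^*$ is the free monoid of words over $\bar X$ with empty word $\emptyset$, and $\mathbb{R}\langle\langle\bar X\rangle\rangle$ is the space of all formal series $c=\sum_{\eta\in\bar X^*}(c,\eta)\eta$ with real coefficients. The quasi-shuffle product is defined on words recursively by $\emptyset\circledast\eta=\eta\circledast\emptyset=\eta$ and, for letters $a,b\in\bar X$ and words $\eta',\xi'\in\bar X^*$, $$(a\eta')\circledast(b\xi')=a\big(\eta'\circledast(b\xi')\big)+b\big((a\eta')\circledast\xi'\big)-[a\,b]\,(\eta'\circledast\xi'),$$ and is extended to series by $c\circledast d=\sum_{\eta,\xi\in\bar X^*}(c,\eta)(d,\xi)\,\eta\circledast\xi$ (a locally finite sum). For sub-alphabets $X_c,X_d\subset\bar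 X$, $[X_cX_d]:=\{[x\,y]:x\in X_c,\ y\in X_d\}$. Rationality: for a finite alphabet $Y$, a subalgebra of $\mathbb{R}\langle\langle Y\rangle\rangle$ (under the catenation product) is rationally closed if it contains the catenation inverse of each of its elements that is invertible in $\mathbb{R}\langle\langle Y\rangle\rangle$; a series in $\mathbb{R}\langle\langle Y\rangle\rangle$ is rational if it belongs to the smallest rationally closed subalgebra containing the polynomials $\mathbb{R}\langle Y\rangle$. A series over $\bar X$ is rational with underlying finite alphabet $Y\subset\bar X$ if it is supported on $Y^*$ and is rational as an element of $\mathbb{R}\langle\langle Y\rangle\rangle$. *)

theory Defs
  imports Complex_Main "HOL-Library.Multiset"
begin

section \<open>The augmented alphabet\<close>

text \<open>
  The type \<open>'x\<close> (finite where it matters) plays the role of the alphabet \<open>X\<close>.  The free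
  commutative semigroup on \<open>X\<close> is the set of nonempty finite multisets over \<open>X\<close>, with multiset
  sum as the bracket.
\<close>

typedef 'x letter = "{M :: 'x multiset. M \<noteq> {#}}"
  by (rule exI[of _ "{#undefined#}"]) simp

setup_lifting type_definition_letter

lift_definition generator :: "'x \<Rightarrow> 'x letter" is "\<lambda>x. {#x#}"
  by simp

lift_definition bracket :: "'x letter \<Rightarrow> 'x letter \<Rightarrow> 'x letter" is "(+)"
  by simp

lemma bracket_commute: "bracket a b = bracket b a"
  by transfer (rule add.commute)

lemma bracket_assoc: "bracket (bracket a b) c = bracket a (bracket b c)"
  by transfer (rule add.assoc)

lemma letter_induct [case_names generator bracket]:
  assumes "\<And>x. P (generator x)" and "\<And>a x. P a \<Longrightarrow> P (bracket a (generator x))"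
  shows "P a"
proof -
  have "P l" if "Rep_letter l = M" for l M
    using that
  proof (induction M arbitrary: l)
    case empty
    then show ?case using Rep_letter[of l] by simp
  next
    case (add x M)
    show ?case
    proof (cases "M = {#}")
      case True
      then have "l = generator x"
        using add.prems by (simp add: generator.rep_eq flip: Rep_letter_inject)
      then show ?thesis using assms(1) by simp
    next
      case False
      then have M: "Rep_letter (Abs_letter M) = M" by (simp add: Abs_letter_inverse)
      then have "l = bracket (Abs_letter M) (generator x)"
        using add.prems by (simp add: bracket.rep_eq generator.rep_eq flip: Rep_letter_inject)
      then show ?thesis using add.IH[OF M] assms(2) by simp
    qed
  qed
  then show ?thesis by blast
qed

definition bracket_set :: "'x letter set \<Rightarrow> 'x letter set \<Rightarrow> 'x letter set" where
  "bracket_set A B = {bracket x y |x y. x \<in> A \<and> y \<in> B}"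


section \<open>Formal power series and rationality\<close>

text \<open>A series is its coefficient function: \<open>c w\<close> is the coefficient of the word \<open>w\<close>.\<close>

type_synonym 'a series = "'a list \<Rightarrow> real"

definition word_series :: "'a list \<Rightarrow> 'a series" where
  "word_series v = (\<lambda>w. if w = v then 1 else 0)"

definition add_series :: "'a series \<Rightarrow> 'a series \<Rightarrow> 'a series" where
  "add_series c d = (\<lambda>w. c w + d w)"

definition scale_series :: "real \<Rightarrow> 'a series \<Rightarrow> 'a series" where
  "scale_series r c = (\<lambda>w. r * c w)"

definition cat :: "'a series \<Rightarrow> 'a series \<Rightarrow> 'a series" where
  "cat c d = (\<lambda>w. \<Sum>(u, v) \<in> {(u, v). u @ v = w}. c u * d v)"

lemma finite_splits: "finite {(u, v). u @ v = w}"
proof (rule finite_subset)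
  show "{(u, v). u @ v = w} \<subseteq> (\<lambda>i. (take i w, drop i w)) ` {..length w}"
  proof clarify
    fix u v
    assume "w = u @ v"
    then show "(u, v) \<in> (\<lambda>i. (take i (u @ v), drop i (u @ v))) ` {..length (u @ v)}"
      by (intro image_eqI[of _ _ "length u"]) auto
  qed
qed simp

text \<open>Series and polynomials over a sub-alphabet \<open>Y\<close> are the ones supported on words over \<open>Y\<close>.\<close>

definition series_over :: "'a set \<Rightarrow> 'a series set" where
  "series_over Y = {c. \<forall>w. c w \<noteq> 0 \<longrightarrow> w \<in> lists Y}"

definition polys_over :: "'a set \<Rightarrow> 'a series set" where
  "polys_over Y = {c \<in> series_over Y. finite {w. c w \<noteq> 0}}"

definition subalgebra_over :: "'a set \<Rightarrow> 'a series set \<Rightarrow> bool" where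
  "subalgebra_over Y A \<longleftrightarrow>
     A \<subseteq> series_over Y \<and>
     word_series [] \<in> A \<and>
     (\<forall>c\<in>A. \<forall>d\<in>A. add_series c d \<in> A) \<and>
     (\<forall>r. \<forall>c\<in>A. scale_series r c \<in> A) \<and>
     (\<forall>c\<in>A. \<forall>d\<in>A. cat c d \<in> A)"

definition cat_inverse :: "'a series \<Rightarrow> 'a series \<Rightarrow> bool" where
  "cat_inverse c d \<longleftrightarrow> cat c d = word_series [] \<and> cat d c = word_series []"

definition rationally_closed :: "'a set \<Rightarrow> 'a series set \<Rightarrow> bool" where
  "rationally_closed Y A \<longleftrightarrow>
     subalgebra_over Y A \<and> (\<forall>c\<in>A. \<forall>d\<in>series_over Y. cat_inverse c d \<longrightarrow> d \<in> A)"

definition rational_series :: "'a set \<Rightarrow> 'a series set" where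
  "rational_series Y = \<Inter>{A. rationally_closed Y A \<and> polys_over Y \<subseteq> A}"

definition rational_over :: "'a set \<Rightarrow> 'a series \<Rightarrow> bool" where
  "rational_over Y c \<longleftrightarrow> finite Y \<and> c \<in> series_over Y \<and> c \<in> rational_series Y"


section \<open>The quasi-shuffle product\<close>

text \<open>\<open>prefix_letter a p\<close> is the series \<open>a p\<close> (left catenation by a letter).\<close>

definition prefix_letter :: "'a \<Rightarrow> 'a series \<Rightarrow> 'a series" where
  "prefix_letter a p = (\<lambda>w. case w of [] \<Rightarrow> 0 | b # v \<Rightarrow> if b = a then p v else 0)"

fun qshuffle_words :: "'x letter list \<Rightarrow> 'x letter list \<Rightarrow> 'x letter series" where
  "qshuffle_words [] \<eta> = word_series \<eta>"
| "qshuffle_words \<eta> [] = word_series \<eta>"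
| "qshuffle_words (a # \<eta>) (b # \<xi>) =
     (\<lambda>w. prefix_letter a (qshuffle_words \<eta> (b # \<xi>)) w
        + prefix_letter b (qshuffle_words (a # \<eta>) \<xi>) w
        - prefix_letter (bracket a b) (qshuffle_words \<eta> \<xi>) w)"

text \<open>
  The coefficient of \<open>w\<close> in the product of two series is a sum over all pairs of words.  Only
  the finitely many pairs whose quasi-shuffle contains \<open>w\<close> contribute; finiteness is proved in
  \<open>finite_qshuffle_pairs\<close>, so the sum below is never the default value for infinite index sets.
\<close>

definition qshuffle :: "'x letter series \<Rightarrow> 'x letter series \<Rightarrow> 'x letter series" where
  "qshuffle c d = (\<lambda>w. \<Sum>(\<eta>, \<xi>) \<in> {(\<eta>, \<xi>). qshuffle_words \<eta> \<xi> w \<noteq> 0}.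
     c \<eta> * d \<xi> * qshuffle_words \<eta> \<xi> w)"

lemma finite_submultisets: "finite {N. N \<subseteq># M}"
proof (induction M)
  case (add x M)
  have "{N. N \<subseteq># add_mset x M} \<subseteq> {N. N \<subseteq># M} \<union> add_mset x ` {N. N \<subseteq># M}"
  proof
    fix N
    assume "N \<in> {N. N \<subseteq># add_mset x M}"
    then have le: "N \<subseteq># add_mset x M" by simp
    show "N \<in> {N. N \<subseteq># M} \<union> add_mset x ` {N. N \<subseteq># M}"
    proof (cases "x \<in># N")
      case True
      then obtain N' where "N = add_mset x N'" by (blast dest: multi_member_split)
      then show ?thesis using le by auto
    next
      case False
      then have "N \<subseteq># M"
        using le by (metis diff_single_trivial subset_eq_diff_conv add_mset_add_single)
      then show ?thesis by simp
    qed
  qed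
  then show ?case by (rule finite_subset) (simp add: add.IH)
qed simp

lemma finite_bracket_decomps: "finite {(a, b). bracket a b = l}"
proof -
  define S where "S = {N. N \<subseteq># Rep_letter l}"
  have "finite (S \<times> S)" by (simp add: S_def finite_submultisets)
  moreover have "(\<lambda>(a, b). (Rep_letter a, Rep_letter b)) ` {(a, b). bracket a b = l} \<subseteq> S \<times> S"
    by (auto simp: S_def bracket.rep_eq)
  moreover have "inj_on (\<lambda>(a, b). (Rep_letter a, Rep_letter b)) {(a, b). bracket a b = l}"
    by (auto simp: inj_on_def Rep_letter_inject)
  ultimately show ?thesis by (meson finite_subset finite_imageD)
qed

lemma finite_qshuffle_pairs:
  fixes w :: "'x letter list"
  shows "finite {(\<eta>, \<xi>). qshuffle_words \<eta> \<xi> w \<noteq> 0}"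
proof (induction w)
  case Nil
  have "{(\<eta>, \<xi>). qshuffle_words \<eta> \<xi> ([] :: 'x letter list) \<noteq> 0} \<subseteq> {([], [])}"
  proof (rule subrelI)
    fix \<eta> \<xi> :: "'x letter list"
    assume "(\<eta>, \<xi>) \<in> {(\<eta>, \<xi>). qshuffle_words \<eta> \<xi> [] \<noteq> 0}"
    then show "(\<eta>, \<xi>) \<in> {([], [])}"
      by (cases \<eta>; cases \<xi>)
        (auto simp: word_series_def prefix_letter_def split: if_splits)
  qed
  then show ?case by (rule finite_subset) simp
next
  case (Cons l w)
  let ?P = "{(\<eta>, \<xi>). qshuffle_words \<eta> \<xi> w \<noteq> 0}"
  let ?D = "{(a, b). bracket a b = l}"
  let ?S = "{([], l # w), (l # w, [])} \<union> (\<lambda>(\<eta>, \<xi>). (l # \<eta>, \<xi>)) ` ?P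
    \<union> (\<lambda>(\<eta>, \<xi>). (\<eta>, l # \<xi>)) ` ?P
    \<union> (\<lambda>((a, b), (\<eta>, \<xi>)). (a # \<eta>, b # \<xi>)) ` (?D \<times> ?P)"
  have "{(\<eta>, \<xi>). qshuffle_words \<eta> \<xi> (l # w) \<noteq> 0} \<subseteq> ?S"
  proof (rule subrelI)
    fix \<eta> \<xi> :: "'x letter list"
    assume "(\<eta>, \<xi>) \<in> {(\<eta>, \<xi>). qshuffle_words \<eta> \<xi> (l # w) \<noteq> 0}"
    then have nz: "qshuffle_words \<eta> \<xi> (l # w) \<noteq> 0" by simp
    show "(\<eta>, \<xi>) \<in> ?S"
    proof (cases "(\<eta>, \<xi>)" rule: qshuffle_words.cases)
      case (3 a \<eta>' b \<xi>')
      then consider "l = a" "qshuffle_words \<eta>' (b # \<xi>') w \<noteq> 0"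
        | "l = b" "qshuffle_words (a # \<eta>') \<xi>' w \<noteq> 0"
        | "l = bracket a b" "qshuffle_words \<eta>' \<xi>' w \<noteq> 0"
        using nz by (fastforce simp: prefix_letter_def split: if_splits)
      then show ?thesis using 3 by cases (force simp: image_iff)+
    qed (use nz in \<open>auto simp: word_series_def split: if_splits\<close>)
  qed
  moreover have "finite ?S"
    using Cons.IH finite_bracket_decomps[of l] by auto
  ultimately show ?case by (rule finite_subset)
qed

end

theory Submission
  imports Defs "HOL-Library.Function_Algebras"
begin

text \<open>
  The proof avoids rational expressions and works with left quotients instead: the left quotient
  \<open>a\<^sup>-\<^sup>1 c\<close> of a series \<open>c\<close> by a letter \<open>a\<close> is \<open>w \<mapsto> c (a w)\<close>.  Over a finite alphabet, a series is
  rational if and only if it lies in a finite-dimensional space of series that is stable under all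
  left quotients (the theorem of Schuetzenberger, in the form given by Fliess and Jacob).  Call
  such a series recognizable.

  Recognizability is visibly preserved by the quasi-shuffle product.  Reading off the first letter
  in the recursion for words, and summing over all pairs of words, gives
  \<open>l\<^sup>-\<^sup>1 (c \<circledast> d) = (l\<^sup>-\<^sup>1 c) \<circledast> d + c \<circledast> (l\<^sup>-\<^sup>1 d) - (\<Sum>[a b] = l. (a\<^sup>-\<^sup>1 c) \<circledast> (b\<^sup>-\<^sup>1 d))\<close>
  with a finite sum, since a letter has finitely many factorizations (\<open>left_quotient_qshuffle\<close>).
  Hence if \<open>c\<close> and \<open>d\<close> lie in stable spaces spanned by \<open>B\<close> and \<open>C\<close>, then \<open>c \<circledast> d\<close> lies in the
  stable space spanned by the finitely many products \<open>b \<circledast> b'\<close> with \<open>b \<in> B\<close> and \<open>b' \<in> C\<close>.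

  It remains to pass between the two notions.  Rational series are recognizable because the
  recognizable series form a rationally closed algebra that contains the polynomials
  (\<open>rational_imp_recognizable\<close>).  Conversely, a spanning set of a stable space satisfies a linear
  system \<open>f i = p i + (\<Sum>j. m i j f j)\<close> with polynomial coefficients, \<open>m i j\<close> without constant
  term; Gaussian elimination solves it using only catenation, addition and inverses of series
  \<open>1 - m\<close>, so that the solution lies in every rationally closed algebra containing the
  coefficients (\<open>proper_linear_system_solution_in_closed\<close>).
\<close>


section \<open>The vector space of series\<close>

lemma add_series_eq_plus: "add_series c d = c + d"
  by (simp add: add_series_def fun_eq_iff)

lemma scale_series_apply [simp]: "scale_series r c w = r * c w"
  by (simp add: scale_series_def)

interpretation series: vector_space "scale_series :: real \<Rightarrow> 'a series \<Rightarrow> 'a series"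
  by unfold_locales (auto simp: fun_eq_iff algebra_simps)

interpretation series_pair: vector_space_pair
  "scale_series :: real \<Rightarrow> 'a series \<Rightarrow> 'a series" "scale_series :: real \<Rightarrow> 'b series \<Rightarrow> 'b series"
  by unfold_locales

abbreviation linear_map :: "('a series \<Rightarrow> 'b series) \<Rightarrow> bool" where
  "linear_map \<equiv> Vector_Spaces.linear scale_series scale_series"

lemma linear_mapI:
  assumes "\<And>c d. f (c + d) = f c + f d" and "\<And>r c. f (scale_series r c) = scale_series r (f c)"
  shows "linear_map f"
  using assms by (simp add: Vector_Spaces.linear_iff series.vector_space_axioms)

lemma sum_series_apply: "(\<Sum>i\<in>I. f i) w = (\<Sum>i\<in>I. f i w)" for f :: "'i \<Rightarrow> 'a series"
  by (induction I rule: infinite_finite_induct) auto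

lemma linear_map_span:
  assumes "linear_map f" and "\<And>b. b \<in> B \<Longrightarrow> f b \<in> series.span C" and "c \<in> series.span B"
  shows "f c \<in> series.span C"
  using assms(3)
proof (induction rule: series.span_induct_alt)
  case base
  have "f 0 \<in> series.span C"
    using series_pair.linear_0[OF assms(1)] series.span_zero by simp
  then show ?case .
next
  case (step r x y)
  have "f (scale_series r x + y) = scale_series r (f x) + f y"
    using assms(1) by (metis series_pair.linear_add series_pair.linear_scale)
  then have "f (scale_series r x + y) \<in> series.span C"
    using step assms(2) by (metis series.span_add series.span_scale)
  then show ?case .
qed

text \<open>
  The products of the elements of two spanning sets span all products.  This is what keeps the
  stable spaces of a catenation and of a quasi-shuffle finite-dimensional.
\<close>

lemma bilinear_map_span:
  assumes "\<And>c. linear_map (f c)" and "\<And>d. linear_map (\<lambda>c. f c d)"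
    and "c \<in> series.span B" and "d \<in> series.span C"
  shows "f c d \<in> series.span ((\<lambda>(b, b'). f b b') ` (B \<times> C))"
proof (rule linear_map_span[OF assms(2) _ assms(3)])
  fix b assume "b \<in> B"
  then show "f b d \<in> series.span ((\<lambda>(b, b'). f b b') ` (B \<times> C))"
    by (intro linear_map_span[OF assms(1) _ assms(4)] series.span_base) auto
qed

lemma series_overI: "(\<And>w. c w \<noteq> 0 \<Longrightarrow> w \<in> lists Y) \<Longrightarrow> c \<in> series_over Y"
  unfolding series_over_def by (intro CollectI allI impI)

lemma series_overD: "c \<in> series_over Y \<Longrightarrow> c w \<noteq> 0 \<Longrightarrow> w \<in> lists Y"
  unfolding series_over_def by (elim CollectE allE impE)


section \<open>Catenation and left quotients\<close>

definition left_quotient :: "'a \<Rightarrow> 'a series \<Rightarrow> 'a series" where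
  "left_quotient a c = (\<lambda>w. c (a # w))"

lemma linear_left_quotient: "linear_map (left_quotient a)"
  by (rule linear_mapI) (auto simp: left_quotient_def fun_eq_iff)

text \<open>
  Quotients replace coefficients in proofs of identities: the product rules below compute quotients
  of products without any sum over the splittings of a word.
\<close>

lemma series_eqI:
  assumes "c [] = d []" and "\<And>a. left_quotient a c = left_quotient a d"
  shows "c = d"
proof
  fix w show "c w = d w"
    using assms by (cases w) (auto simp: left_quotient_def fun_eq_iff)
qed

lemma left_quotient_one [simp]: "left_quotient a (word_series []) = 0"
  by (simp add: left_quotient_def word_series_def fun_eq_iff)

lemma cat_linear_left: "linear_map (\<lambda>c. cat c d)"
  by (rule linear_mapI)
    (auto simp: cat_def fun_eq_iff split_def sum.distrib sum_distrib_left algebra_simps)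

lemma cat_linear_right: "linear_map (cat c)"
  by (rule linear_mapI)
    (auto simp: cat_def fun_eq_iff split_def sum.distrib sum_distrib_left algebra_simps)

lemmas cat_simps =
  series_pair.linear_0[OF cat_linear_left] series_pair.linear_0[OF cat_linear_right]
  series_pair.linear_add[OF cat_linear_left] series_pair.linear_add[OF cat_linear_right]
  series_pair.linear_diff[OF cat_linear_left] series_pair.linear_diff[OF cat_linear_right]
  series_pair.linear_scale[OF cat_linear_left] series_pair.linear_scale[OF cat_linear_right]
  series_pair.linear_sum[OF cat_linear_left] series_pair.linear_sum[OF cat_linear_right]

lemma cat_Nil [simp]: "cat c d [] = c [] * d []"
proof -
  have "{(u, v). u @ v = []} = {([] :: 'a list, [] :: 'a list)}" by auto
  then show ?thesis by (simp add: cat_def)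
qed

text \<open>
  A splitting of \<open>a w\<close> either gives the letter \<open>a\<close> to the left factor or has an empty left factor,
  which contributes the constant term of \<open>c\<close>.
\<close>

lemma left_quotient_cat:
  "left_quotient a (cat c d) = cat (left_quotient a c) d + scale_series (c []) (left_quotient a d)"
proof
  fix w
  have "{(u, v). u @ v = a # w}
      = insert ([], a # w) ((\<lambda>(u, v). (a # u, v)) ` {(u, v). u @ v = w})"
    by (auto simp: append_eq_Cons_conv image_iff)
  moreover have "inj_on (\<lambda>(u, v). (a # u, v)) {(u, v). u @ v = w}"
    by (auto simp: inj_on_def)
  ultimately have "cat c d (a # w) = c [] * d (a # w) + (\<Sum>(u, v)\<in>{(u, v). u @ v = w}. c (a # u) * d v)"
    using finite_splits[of w]
    by (subst cat_def) (simp add: sum.reindex split_def image_iff)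
  then show "left_quotient a (cat c d) w
      = (cat (left_quotient a c) d + scale_series (c []) (left_quotient a d)) w"
    by (simp add: left_quotient_def cat_def)
qed

lemma cat_assoc: "cat (cat a b) c = cat a (cat b c)"
proof -
  have "cat (cat a b) c w = cat a (cat b c) w" for w
  proof (induction w arbitrary: a)
    case (Cons x w)
    have "left_quotient x (cat (cat a b) c) w = left_quotient x (cat a (cat b c)) w"
      by (simp add: left_quotient_cat cat_simps Cons algebra_simps)
    then show ?case by (simp add: left_quotient_def)
  qed (simp add: algebra_simps)
  then show ?thesis by blast
qed

lemma cat_one_left [simp]: "cat (word_series []) c = c"
  by (rule series_eqI) (simp_all add: left_quotient_cat cat_simps, simp_all add: word_series_def)

lemma cat_one_right [simp]: "cat c (word_series []) = c"
proof -
  have "cat c (word_series []) w = c w" for w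
  proof (induction w arbitrary: c)
    case (Cons x w)
    have "left_quotient x (cat c (word_series [])) w = left_quotient x c w"
      by (simp add: left_quotient_cat Cons)
    then show ?case by (simp add: left_quotient_def)
  qed (simp add: word_series_def)
  then show ?thesis by blast
qed

lemma cat_eq_sum_take_drop: "cat c d w = (\<Sum>i\<le>length w. c (take i w) * d (drop i w))"
  unfolding cat_def
  by (rule sum.reindex_bij_witness[of _ "\<lambda>i. (take i w, drop i w)" "\<lambda>(u, v). length u"]) auto

lemma series_over_cat:
  assumes "c \<in> series_over Y" and "d \<in> series_over Y"
  shows "cat c d \<in> series_over Y"
proof (rule series_overI)
  fix w assume "cat c d w \<noteq> 0"
  then obtain i where "c (take i w) \<noteq> 0" "d (drop i w) \<noteq> 0"
    unfolding cat_eq_sum_take_drop by (elim sum.not_neutral_contains_not_neutral) auto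
  then have "take i w \<in> lists Y" and "drop i w \<in> lists Y"
    using assms by (metis series_overD)+
  then have "take i w @ drop i w \<in> lists Y" by (simp only: append_in_lists_conv)
  then show "w \<in> lists Y" by (simp only: append_take_drop_id)
qed

text \<open>
  The geometric series \<open>1 + m + m m + \<dots>\<close> of a series without constant term, in the form of the
  recursion that \<open>star m = 1 + m star m\<close> forces on the coefficients.
\<close>

fun star :: "'a series \<Rightarrow> 'a series" where
  "star m [] = 1"
| "star m (x # w) = (\<Sum>i\<in>{..length w}. m (x # take i w) * star m (drop i w))"

lemma left_quotient_star: "left_quotient x (star m) = cat (left_quotient x m) (star m)"
  by (rule ext) (simp add: left_quotient_def cat_eq_sum_take_drop)

lemma cat_star:
  assumes "m [] = 0"
  shows "cat (word_series [] - m) (star m) = word_series []"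
proof -
  have "star m = word_series [] + cat m (star m)"
    by (rule series_eqI)
      (simp_all add: series_pair.linear_add[OF linear_left_quotient] left_quotient_cat
        left_quotient_star assms, simp add: word_series_def)
  then show ?thesis by (simp add: cat_simps) (metis add_diff_cancel_right')
qed

text \<open>
  The recursion for the star yields a right inverse only.  As \<open>star m\<close> has constant term \<open>1\<close>, it has
  a right inverse of its own, and by associativity this has to be \<open>1 - m\<close>.
\<close>

lemma cat_inverse_star:
  assumes "m [] = 0"
  shows "cat_inverse (word_series [] - m) (star m)"
proof -
  define r where "r = star (word_series [] - star m)"
  have right: "cat (star m) r = word_series []"
    using cat_star[of "word_series [] - star m"] by (simp add: r_def word_series_def)
  have "word_series [] - m = cat (cat (word_series [] - m) (star m)) r"
    by (simp only: cat_assoc right cat_one_right)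
  then have "r = word_series [] - m" by (simp add: cat_star[where m = m, OF assms])
  then show ?thesis using right cat_star[where m = m, OF assms] by (simp add: cat_inverse_def)
qed

lemma series_over_star:
  assumes "m \<in> series_over Y"
  shows "star m \<in> series_over Y"
proof -
  have "star m w \<noteq> 0 \<longrightarrow> w \<in> lists Y" for w
    using assms
  proof (induction m w rule: star.induct)
    case (2 m x w)
    show ?case
    proof
      assume "star m (x # w) \<noteq> 0"
      then obtain i where i: "i \<le> length w" "m (x # take i w) \<noteq> 0" "star m (drop i w) \<noteq> 0"
        unfolding star.simps by (elim sum.not_neutral_contains_not_neutral) auto
      then have "drop i w \<in> lists Y" and "x # take i w \<in> lists Y"
        using 2 by (metis atMost_iff, metis series_overD)
      then have "(x # take i w) @ drop i w \<in> lists Y" by (simp only: append_in_lists_conv)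
      then show "x # w \<in> lists Y" by (simp only: append_Cons append_take_drop_id)
    qed
  qed simp
  then show ?thesis by (simp add: series_overI)
qed


section \<open>Rational series are recognizable\<close>

definition shift_stable :: "'a series set \<Rightarrow> bool" where
  "shift_stable B \<longleftrightarrow> (\<forall>a. \<forall>b\<in>B. left_quotient a b \<in> series.span B)"

text \<open>
  The finite-dimensional space is given by a spanning set rather than a basis, so that unions of
  such sets and sets of products can be used directly as new spanning sets.
\<close>

definition recognizable :: "'a series \<Rightarrow> bool" where
  "recognizable c \<longleftrightarrow> (\<exists>B. finite B \<and> shift_stable B \<and> c \<in> series.span B)"

lemma left_quotient_in_span:
  assumes "shift_stable B" and "c \<in> series.span B"
  shows "left_quotient a c \<in> series.span B"
  using assms(1)
  by (intro linear_map_span[OF linear_left_quotient _ assms(2)]) (simp add: shift_stable_def)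

lemma recognizable_scale: "recognizable c \<Longrightarrow> recognizable (scale_series r c)"
  unfolding recognizable_def by (blast intro: series.span_scale)

lemma in_span_Un1: "c \<in> series.span B \<Longrightarrow> c \<in> series.span (B \<union> C)"
  using series.span_mono[of B "B \<union> C"] by blast

lemma in_span_Un2: "c \<in> series.span C \<Longrightarrow> c \<in> series.span (B \<union> C)"
  using series.span_mono[of C "B \<union> C"] by blast

lemma recognizable_add:
  assumes "recognizable c" and "recognizable d"
  shows "recognizable (c + d)"
proof -
  obtain B C where "finite B" "shift_stable B" "c \<in> series.span B"
    and "finite C" "shift_stable C" "d \<in> series.span C"
    using assms unfolding recognizable_def by blast
  then have "finite (B \<union> C)" "shift_stable (B \<union> C)" "c + d \<in> series.span (B \<union> C)"
    by (auto simp: shift_stable_def intro: series.span_add in_span_Un1 in_span_Un2)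
  then show ?thesis unfolding recognizable_def by blast
qed

text \<open>
  By the product rule, quotients of the products \<open>b b'\<close> stay in the span of these products and of
  \<open>C\<close>, the summand \<open>C\<close> coming from the constant term of \<open>b\<close>.
\<close>

lemma recognizable_cat:
  assumes "recognizable c" and "recognizable d"
  shows "recognizable (cat c d)"
proof -
  obtain B C where B: "finite B" "shift_stable B" "c \<in> series.span B"
    and C: "finite C" "shift_stable C" "d \<in> series.span C"
    using assms unfolding recognizable_def by blast
  let ?S = "(\<lambda>(b, b'). cat b b') ` (B \<times> C) \<union> C"
  have mem: "cat b b' \<in> series.span ?S" if "b \<in> series.span B" "b' \<in> series.span C" for b b'
    by (intro in_span_Un1 bilinear_map_span that cat_linear_left cat_linear_right)
  have "left_quotient a s \<in> series.span ?S" if "s \<in> ?S" for a s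
    using that
  proof
    assume "s \<in> (\<lambda>(b, b'). cat b b') ` (B \<times> C)"
    then obtain b b' where s: "s = cat b b'" "b \<in> B" "b' \<in> C" by auto
    then have "left_quotient a b \<in> series.span B" "left_quotient a b' \<in> series.span C"
      using B C by (auto simp: shift_stable_def)
    then show ?thesis
      using s by (auto simp: left_quotient_cat
          intro!: series.span_add series.span_scale mem intro: series.span_base in_span_Un2)
  next
    assume "s \<in> C"
    then show ?thesis using C by (auto simp: shift_stable_def intro: in_span_Un2)
  qed
  then have "shift_stable ?S" by (simp add: shift_stable_def)
  moreover have "finite ?S" using B C by simp
  ultimately show ?thesis unfolding recognizable_def using mem[OF B(3) C(3)] by blast
qed

text \<open>
  Taking quotients in \<open>c d = 1\<close> expresses the quotients of \<open>d\<close> through products \<open>b d\<close>: they are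
  \<open>- (a\<^sup>-\<^sup>1 c) d\<close> divided by the constant term of \<open>c\<close>.
\<close>

lemma recognizable_inverse:
  assumes "recognizable c" and inv: "cat_inverse c d"
  shows "recognizable d"
proof -
  obtain B where B: "finite B" "shift_stable B" "c \<in> series.span B"
    using assms unfolding recognizable_def by blast
  let ?S = "insert d ((\<lambda>b. cat b d) ` B)"
  have mem: "cat b d \<in> series.span ?S" if "b \<in> series.span B" for b
    using that by (rule linear_map_span[OF cat_linear_left, rotated]) (auto intro: series.span_base)
  have unit: "cat c d = word_series []" using inv by (simp add: cat_inverse_def)
  then have "c [] * d [] = 1" by (metis cat_Nil word_series_def)
  then have c0: "c [] \<noteq> 0" by auto
  have d: "left_quotient a d \<in> series.span ?S" for a
  proof -
    have "cat (left_quotient a c) d + scale_series (c []) (left_quotient a d) = 0"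
      using unit by (metis left_quotient_cat left_quotient_one)
    then have "scale_series (c []) (left_quotient a d) = - cat (left_quotient a c) d"
      by (metis add_eq_0_iff)
    then have "left_quotient a d = scale_series (1 / c []) (- cat (left_quotient a c) d)"
      using c0 by (metis series.scale_left_imp_eq series.scale_scale series.scale_one
          nonzero_eq_divide_eq mult.commute)
    then show ?thesis
      by (simp only:) (intro series.span_scale series.span_neg mem left_quotient_in_span[OF B(2,3)])
  qed
  have "left_quotient a (cat b d) \<in> series.span ?S" if "b \<in> B" for a b
    unfolding left_quotient_cat
    using that B by (intro series.span_add series.span_scale d mem) (auto simp: shift_stable_def)
  then have "shift_stable ?S" using d by (auto simp: shift_stable_def)
  moreover have "finite ?S" using B by simp
  ultimately show ?thesis unfolding recognizable_def by (blast intro: series.span_base)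
qed

text \<open>
  The iterated quotients of a word are its suffixes and zero.
\<close>

lemma recognizable_word_series: "recognizable (word_series v)"
proof -
  let ?B = "insert 0 ((\<lambda>i. word_series (drop i v)) ` {..length v})"
  have quot: "left_quotient a (word_series (drop i v)) \<in> ?B" for a i
  proof (cases "i < length v \<and> v ! i = a")
    case True
    then have "drop i v = a # drop (Suc i) v" by (metis Cons_nth_drop_Suc)
    then have "left_quotient a (word_series (drop i v)) = word_series (drop (Suc i) v)"
      by (simp add: left_quotient_def word_series_def fun_eq_iff)
    then show ?thesis using True by auto
  next
    case False
    then have "drop i v \<noteq> a # w" for w
      by (metis drop_eq_Nil hd_drop_conv_nth leI list.distinct(1) list.sel(1))
    then have "left_quotient a (word_series (drop i v)) = 0"
      by (auto simp: left_quotient_def word_series_def fun_eq_iff dest: sym)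
    then show ?thesis by simp
  qed
  have "left_quotient a b \<in> ?B" if "b \<in> ?B" for a b
    using that quot by (auto simp: series_pair.linear_0[OF linear_left_quotient] simp del: insert_iff)
  then have "shift_stable ?B"
    unfolding shift_stable_def by (blast intro: series.span_base)
  moreover have "word_series v \<in> series.span ?B"
    by (rule series.span_base) force
  ultimately show ?thesis unfolding recognizable_def by (meson finite.insertI finite_atMost finite_imageI)
qed

lemma recognizable_if_finite_support:
  assumes "finite {w. c w \<noteq> 0}"
  shows "recognizable c"
proof -
  have "c = (\<Sum>v\<in>{w. c w \<noteq> 0}. scale_series (c v) (word_series v))"
    using assms by (auto simp: fun_eq_iff sum_series_apply word_series_def if_distrib cong: if_cong)
  moreover have "recognizable (\<Sum>v\<in>V. scale_series (c v) (word_series v))" if "finite V" for V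
    using that
  proof induction
    case empty
    have "recognizable 0"
      using recognizable_scale[OF recognizable_word_series, of 0] by simp
    then show ?case by (simp add: zero_fun_def)
  next
    case (insert v V)
    then have "recognizable (\<Sum>v\<in>V. scale_series (c v) (word_series v))" by blast
    with insert.hyps have "recognizable (\<Sum>v\<in>insert v V. scale_series (c v) (word_series v))"
      by (simp add: recognizable_add recognizable_scale recognizable_word_series)
    then show ?case .
  qed
  ultimately show ?thesis using assms by metis
qed

lemma series_over_closed:
  "word_series [] \<in> series_over Y"
  "c \<in> series_over Y \<Longrightarrow> d \<in> series_over Y \<Longrightarrow> c + d \<in> series_over Y"
  "c \<in> series_over Y \<Longrightarrow> scale_series r c \<in> series_over Y"
proof -
  show "c + d \<in> series_over Y" if "c \<in> series_over Y" "d \<in> series_over Y"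
  proof (rule series_overI)
    fix w assume "(c + d) w \<noteq> 0"
    then have "c w \<noteq> 0 \<or> d w \<noteq> 0" by auto
    then show "w \<in> lists Y" using that by (metis series_overD)
  qed
qed (auto simp: series_over_def word_series_def)

text \<open>
  Rational series form the smallest rationally closed algebra above the polynomials, so it suffices
  that the recognizable series over \<open>Y\<close> form one.
\<close>

lemma rational_imp_recognizable:
  assumes "c \<in> rational_series Y"
  shows "recognizable c"
proof -
  let ?A = "{c \<in> series_over Y. recognizable c}"
  have "rationally_closed Y ?A"
    unfolding rationally_closed_def subalgebra_over_def add_series_eq_plus
    by (auto simp: series_over_closed series_over_cat recognizable_word_series
        intro: recognizable_add recognizable_scale recognizable_cat recognizable_inverse)
  moreover have "polys_over Y \<subseteq> ?A"
    by (auto simp: polys_over_def recognizable_if_finite_support)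
  ultimately show ?thesis using assms unfolding rational_series_def by blast
qed


section \<open>Recognizable series over a finite alphabet are rational\<close>

lemma subalgebra_diff_sum_closed:
  assumes "subalgebra_over Y A"
  shows "c \<in> A \<Longrightarrow> d \<in> A \<Longrightarrow> c - d \<in> A"
    and "(\<And>i. i \<in> I \<Longrightarrow> f i \<in> A) \<Longrightarrow> (\<Sum>i\<in>I. f i) \<in> A"
proof -
  note closed = assms[unfolded subalgebra_over_def add_series_eq_plus]
  show "c - d \<in> A" if "c \<in> A" "d \<in> A"
  proof -
    have "c - d = c + scale_series (- 1) d" by (simp add: fun_eq_iff)
    then show ?thesis using closed that by metis
  qed
  have "scale_series 0 (word_series []) \<in> A" using closed by blast
  then have "0 \<in> A" by simp
  then show "(\<Sum>i\<in>I. f i) \<in> A" if "\<And>i. i \<in> I \<Longrightarrow> f i \<in> A"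
    using that closed by (induction I rule: infinite_finite_induct) auto
qed

text \<open>
  Gaussian elimination.  The equation of an unknown \<open>f k\<close> is solved for it by multiplying with the
  inverse of \<open>1 - m k k\<close>, which exists because \<open>m k k\<close> has no constant term and which the closed
  algebra contains.  Substituting the result into the other equations leaves a system of the same
  kind in one unknown less: the new coefficients are again without constant term.
\<close>

lemma proper_linear_system_solution_in_closed:
  assumes A: "rationally_closed Y A" and "finite I"
    and "\<And>i. i \<in> I \<Longrightarrow> p i \<in> A"
    and "\<And>i j. i \<in> I \<Longrightarrow> j \<in> I \<Longrightarrow> m i j \<in> A \<and> m i j [] = 0"
    and "\<And>i. i \<in> I \<Longrightarrow> f i = p i + (\<Sum>j\<in>I. cat (m i j) (f j))"
    and "i \<in> I"
  shows "f i \<in> A"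
  using assms(2-6)
proof (induction I arbitrary: p m i rule: finite_induct)
  case empty
  then show ?case by simp
next
  case (insert k I)
  have sub: "subalgebra_over Y A" using A by (simp add: rationally_closed_def)
  have closed: "word_series [] \<in> A" "\<And>c d. c \<in> A \<Longrightarrow> d \<in> A \<Longrightarrow> c + d \<in> A"
    "\<And>c d. c \<in> A \<Longrightarrow> d \<in> A \<Longrightarrow> cat c d \<in> A" "A \<subseteq> series_over Y"
    using sub by (auto simp: subalgebra_over_def add_series_eq_plus)
  have p: "p i \<in> A" if "i \<in> insert k I" for i using insert.prems(1) that .
  have m: "m i j \<in> A" "m i j [] = 0" if "i \<in> insert k I" "j \<in> insert k I" for i j
    using insert.prems(2) that by blast+
  have f: "f i = p i + (\<Sum>j\<in>insert k I. cat (m i j) (f j))" if "i \<in> insert k I" for i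
    by (rule insert.prems(3)[OF that])
  define s where "s = star (m k k)"
  have inv: "cat_inverse (word_series [] - m k k) s"
    unfolding s_def by (rule cat_inverse_star) (simp add: m)
  have s: "s \<in> A"
  proof -
    have "s \<in> series_over Y"
      unfolding s_def using closed(4) m(1)[of k k] by (intro series_over_star) auto
    moreover have "word_series [] - m k k \<in> A"
      by (intro subalgebra_diff_sum_closed(1)[OF sub] closed m) auto
    ultimately show ?thesis using A inv unfolding rationally_closed_def by blast
  qed
  have "f k = p k + (cat (m k k) (f k) + (\<Sum>j\<in>I. cat (m k j) (f j)))"
    using f[of k] insert.hyps by simp
  then have "cat (word_series [] - m k k) (f k) = p k + (\<Sum>j\<in>I. cat (m k j) (f j))"
    by (simp add: cat_simps algebra_simps)
  moreover have "cat s (cat (word_series [] - m k k) (f k)) = f k"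
    using inv by (simp only: cat_inverse_def cat_one_left flip: cat_assoc)
  ultimately have "f k = cat s (p k + (\<Sum>j\<in>I. cat (m k j) (f j)))" by simp
  then have fk: "f k = cat s (p k) + (\<Sum>j\<in>I. cat (cat s (m k j)) (f j))"
    by (simp add: cat_simps cat_assoc)
  have I: "f i \<in> A" if "i \<in> I" for i
  proof (rule insert.IH[OF _ _ _ that])
    fix i assume i: "i \<in> I"
    show "p i + cat (m i k) (cat s (p k)) \<in> A"
      using i by (intro closed p m s) auto
    show "f i = (p i + cat (m i k) (cat s (p k)))
        + (\<Sum>j\<in>I. cat (m i j + cat (m i k) (cat s (m k j))) (f j))"
    proof -
      have "f i = p i + (cat (m i k) (f k) + (\<Sum>j\<in>I. cat (m i j) (f j)))"
        using f[of i] insert.hyps i by simp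
      also have "cat (m i k) (f k)
          = cat (m i k) (cat s (p k)) + (\<Sum>j\<in>I. cat (cat (m i k) (cat s (m k j))) (f j))"
        by (subst fk) (simp add: cat_simps cat_assoc)
      finally show ?thesis by (simp add: cat_simps sum.distrib fun_eq_iff)
    qed
    fix j assume j: "j \<in> I"
    show "m i j + cat (m i k) (cat s (m k j)) \<in> A
        \<and> (m i j + cat (m i k) (cat s (m k j))) [] = 0"
      using i j m(2) by (auto intro!: closed m s)
  qed
  have "f k \<in> A"
    by (subst fk, intro closed s p m subalgebra_diff_sum_closed(2)[OF sub] I) auto
  then show ?case using I insert.prems(4) by blast
qed

text \<open>
  A series is its constant term plus the sum of \<open>a (a\<^sup>-\<^sup>1 f)\<close> over the letters \<open>a\<close>.  Expanding the
  quotients of a finite stable set \<open>B\<close> in \<open>B\<close> turns this into a linear system for the elements of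
  \<open>B\<close>, whose coefficients are polynomials because the alphabet is finite.
\<close>

lemma recognizable_imp_rational:
  assumes "finite Y" and c: "c \<in> series_over Y" and "recognizable c"
  shows "c \<in> rational_series Y"
  unfolding rational_series_def
proof (intro InterI, clarify)
  fix A assume A: "rationally_closed Y A" and polys: "polys_over Y \<subseteq> A"
  obtain B where B: "finite B" "shift_stable B" "c \<in> series.span B"
    using assms unfolding recognizable_def by blast
  \<comment> \<open>The elements of \<open>B\<close> may involve letters outside \<open>Y\<close>, possibly infinitely many.  Their
      restrictions to words over \<open>Y\<close> satisfy the system in which only the letters of \<open>Y\<close> occur.\<close>
  define R :: "'a series \<Rightarrow> 'a series" where "R = (\<lambda>c w. if w \<in> lists Y then c w else 0)"
  have R: "linear_map R"
    by (rule linear_mapI) (auto simp: R_def fun_eq_iff)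
  define \<mu> where "\<mu> = (\<lambda>a b. SOME u. left_quotient a b = (\<Sum>v\<in>B. scale_series (u v) v))"
  have \<mu>: "left_quotient a b = (\<Sum>v\<in>B. scale_series (\<mu> a b v) v)" if "b \<in> B" for a b
  proof -
    have "left_quotient a b \<in> series.span B" using B(2) that by (simp add: shift_stable_def)
    then have "\<exists>u. left_quotient a b = (\<Sum>v\<in>B. scale_series (u v) v)"
      unfolding series.span_finite[OF B(1)] by blast
    then show ?thesis unfolding \<mu>_def by (rule someI_ex)
  qed
  \<comment> \<open>\<open>m b v\<close> is the linear polynomial with coefficient \<open>\<mu> a b v\<close> at each letter \<open>a\<close> of \<open>Y\<close>.\<close>
  define m :: "'a series \<Rightarrow> 'a series \<Rightarrow> 'a series" where
    "m = (\<lambda>b v w. case w of [a] \<Rightarrow> if a \<in> Y then \<mu> a b v else 0 | _ \<Rightarrow> 0)"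
  have m_Nil: "m b v [] = 0" for b v by (simp add: m_def)
  have lq_m: "left_quotient a (m b v) = scale_series (if a \<in> Y then \<mu> a b v else 0) (word_series [])"
    for a b v
    by (auto simp: left_quotient_def m_def word_series_def fun_eq_iff split: list.splits)
  have sub: "subalgebra_over Y A" using A by (simp add: rationally_closed_def)
  have scale: "scale_series r d \<in> A" if "d \<in> A" for r d
    using sub that by (simp add: subalgebra_over_def)
  have RB: "R b \<in> A" if "b \<in> B" for b
  proof (rule proper_linear_system_solution_in_closed[OF A B(1) _ _ _ that])
    fix b assume b: "b \<in> B"
    show "scale_series (b []) (word_series []) \<in> A"
      using sub by (intro scale) (simp add: subalgebra_over_def)
    show "m b v \<in> A \<and> m b v [] = 0" for v
    proof
      have "m b v w \<noteq> 0 \<Longrightarrow> w \<in> (\<lambda>a. [a]) ` Y" for w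
        by (auto simp: m_def split: list.splits if_splits)
      then have sub: "{w. m b v w \<noteq> 0} \<subseteq> (\<lambda>a. [a]) ` Y" by blast
      then have "m b v \<in> polys_over Y"
        using finite_subset[OF sub] \<open>finite Y\<close> by (auto simp: polys_over_def series_over_def)
      then show "m b v \<in> A" using polys by blast
    qed (rule m_Nil)
    show "R b = scale_series (b []) (word_series []) + (\<Sum>v\<in>B. cat (m b v) (R v))"
    proof (rule series_eqI)
      show "R b [] = (scale_series (b []) (word_series []) + (\<Sum>v\<in>B. cat (m b v) (R v))) []"
        by (simp add: R_def sum_series_apply m_Nil word_series_def)
    next
      fix a
      have "left_quotient a (R b) = scale_series (if a \<in> Y then 1 else 0) (R (left_quotient a b))"
        by (auto simp: R_def left_quotient_def fun_eq_iff)
      also have "\<dots> = (\<Sum>v\<in>B. scale_series (if a \<in> Y then \<mu> a b v else 0) (R v))"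
        by (simp add: \<mu>[OF b] series_pair.linear_sum[OF R] series_pair.linear_scale[OF R])
      also have "\<dots> = left_quotient a (\<Sum>v\<in>B. cat (m b v) (R v))"
        by (simp add: series_pair.linear_sum[OF linear_left_quotient] left_quotient_cat lq_m
            cat_simps m_Nil)
      finally show "left_quotient a (R b)
          = left_quotient a (scale_series (b []) (word_series []) + (\<Sum>v\<in>B. cat (m b v) (R v)))"
        by (simp add: series_pair.linear_add[OF linear_left_quotient]
            series_pair.linear_scale[OF linear_left_quotient])
    qed
  qed
  obtain u where "c = (\<Sum>v\<in>B. scale_series (u v) v)"
    using B(3) unfolding series.span_finite[OF B(1)] by blast
  then have "R c = (\<Sum>v\<in>B. scale_series (u v) (R v))"
    by (simp add: series_pair.linear_sum[OF R] series_pair.linear_scale[OF R])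
  also have "\<dots> \<in> A" by (intro subalgebra_diff_sum_closed(2)[OF sub] scale RB)
  also have "R c = c" using c by (auto simp: R_def series_over_def fun_eq_iff)
  finally show "c \<in> A" .
qed


section \<open>Left quotients of quasi-shuffles\<close>

lemma qshuffle_eq_sum:
  assumes "finite F" and "{(\<eta>, \<xi>). qshuffle_words \<eta> \<xi> w \<noteq> 0} \<subseteq> F"
  shows "qshuffle c d w = (\<Sum>(\<eta>, \<xi>)\<in>F. c \<eta> * d \<xi> * qshuffle_words \<eta> \<xi> w)"
  unfolding qshuffle_def using assms by (intro sum.mono_neutral_left) auto

lemma qshuffle_linear_left: "linear_map (\<lambda>c. qshuffle c d)"
  by (rule linear_mapI)
    (auto simp: qshuffle_def fun_eq_iff split_def sum.distrib sum_distrib_left algebra_simps)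

lemma qshuffle_linear_right: "linear_map (qshuffle c)"
  by (rule linear_mapI)
    (auto simp: qshuffle_def fun_eq_iff split_def sum.distrib sum_distrib_left algebra_simps)

lemma qshuffle_words_Nil_right [simp]: "qshuffle_words \<eta> [] = word_series \<eta>"
  by (cases \<eta>) auto

text \<open>
  The recursion of the product read backwards, from the first letter \<open>l\<close> of a word in the result.
  Here \<open>prefix_letter a g \<eta>\<close> serves as a case distinction on an input word: it strips the letter
  \<open>a\<close> from \<open>\<eta>\<close> and is zero if \<open>\<eta>\<close> does not start with it.  In this form the formula also covers the
  products with an empty word, where the other word has to start with \<open>l\<close>.
\<close>

lemma qshuffle_words_Cons:
  "qshuffle_words \<eta> \<xi> (l # w) =
     prefix_letter l (\<lambda>\<eta>'. qshuffle_words \<eta>' \<xi> w) \<eta>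
   + prefix_letter l (\<lambda>\<xi>'. qshuffle_words \<eta> \<xi>' w) \<xi>
   - (\<Sum>(a, b)\<in>{(a, b). bracket a b = l}.
        prefix_letter a (\<lambda>\<eta>'. prefix_letter b (\<lambda>\<xi>'. qshuffle_words \<eta>' \<xi>' w) \<xi>) \<eta>)"
proof (cases "(\<eta>, \<xi>)" rule: qshuffle_words.cases)
  case (3 a \<eta>' b \<xi>')
  have "(\<Sum>(a', b')\<in>{(a, b). bracket a b = l}.
      prefix_letter a' (\<lambda>\<eta>'. prefix_letter b' (\<lambda>\<xi>'. qshuffle_words \<eta>' \<xi>' w) \<xi>) \<eta>)
    = (\<Sum>p\<in>{(a, b). bracket a b = l}. if p = (a, b) then qshuffle_words \<eta>' \<xi>' w else 0)"
    using 3 by (intro sum.cong) (auto simp: prefix_letter_def split: if_splits)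
  also have "\<dots> = (if bracket a b = l then qshuffle_words \<eta>' \<xi>' w else 0)"
    using finite_bracket_decomps[of l] by simp
  finally show ?thesis by (simp only:) (use 3 in \<open>auto simp: prefix_letter_def\<close>)
qed (auto simp: prefix_letter_def word_series_def split: list.splits)

text \<open>
  Summing the previous identity over all pairs of words, weighted with the coefficients of \<open>c\<close> and
  \<open>d\<close>: stripping letters from the words of a pair amounts to taking quotients of \<open>c\<close> and \<open>d\<close>.
\<close>

lemma left_quotient_qshuffle:
  fixes c d :: "'x letter series"
  shows "left_quotient l (qshuffle c d) =
     qshuffle (left_quotient l c) d + qshuffle c (left_quotient l d)
   - (\<Sum>(a, b)\<in>{(a, b). bracket a b = l}. qshuffle (left_quotient a c) (left_quotient b d))"
proof
  fix w :: "'x letter list"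
  let ?D = "{(a, b). bracket a b = l}"
  define P where "P = {(\<eta>, \<xi>). qshuffle_words \<eta> \<xi> w \<noteq> 0}"
  define F1 where "F1 = (\<lambda>(\<eta>, \<xi>). (l # \<eta>, \<xi>)) ` P"
  define F2 where "F2 = (\<lambda>(\<eta>, \<xi>). (\<eta>, l # \<xi>)) ` P"
  define F3 where "F3 = (\<lambda>(a, b). (\<lambda>(\<eta>, \<xi>). (a # \<eta>, b # \<xi>)) ` P)"
  \<comment> \<open>The terms of the recursion are nonzero on different sets of pairs of words; one finite set
      containing them all lets the sum be split into these terms.\<close>
  define F where "F = {(\<eta>, \<xi>). qshuffle_words \<eta> \<xi> (l # w) \<noteq> 0} \<union> F1 \<union> F2 \<union> (\<Union>p\<in>?D. F3 p)"
  have "finite P" unfolding P_def by (rule finite_qshuffle_pairs)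
  then have "finite F"
    unfolding F_def F1_def F2_def F3_def
    using finite_qshuffle_pairs finite_bracket_decomps by (auto simp: split_def)
  define h where "h = (\<lambda>(\<eta>, \<xi>). c \<eta> * d \<xi>)"
  define t1 where "t1 = (\<lambda>(\<eta>, \<xi>). prefix_letter l (\<lambda>\<eta>'. qshuffle_words \<eta>' \<xi> w) \<eta>)"
  define t2 where "t2 = (\<lambda>(\<eta>, \<xi>). prefix_letter l (\<lambda>\<xi>'. qshuffle_words \<eta> \<xi>' w) \<xi>)"
  define t3 where "t3 = (\<lambda>(a, b) (\<eta>, \<xi>).
      prefix_letter a (\<lambda>\<eta>'. prefix_letter b (\<lambda>\<xi>'. qshuffle_words \<eta>' \<xi>' w) \<xi>) \<eta>)"
  have restrict: "(\<Sum>q\<in>F. h q * t q) = (\<Sum>q\<in>G. h q * t q)"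
    if "G \<subseteq> F" and "\<And>\<eta> \<xi>. (\<eta>, \<xi>) \<notin> G \<Longrightarrow> t (\<eta>, \<xi>) = 0" for t G
    using \<open>finite F\<close> that by (intro sum.mono_neutral_right) auto
  have t1: "t1 (\<eta>, \<xi>) = 0" if "(\<eta>, \<xi>) \<notin> F1" for \<eta> \<xi>
    using that by (cases \<eta>) (force simp: t1_def F1_def P_def prefix_letter_def image_iff)+
  have t2: "t2 (\<eta>, \<xi>) = 0" if "(\<eta>, \<xi>) \<notin> F2" for \<eta> \<xi>
    using that by (cases \<xi>) (force simp: t2_def F2_def P_def prefix_letter_def image_iff)+
  have t3: "t3 p (\<eta>, \<xi>) = 0" if "(\<eta>, \<xi>) \<notin> F3 p" for p \<eta> \<xi>
    using that
    by (cases p; cases \<eta>; cases \<xi>) (force simp: t3_def F3_def P_def prefix_letter_def image_iff)+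
  have "left_quotient l (qshuffle c d) w = (\<Sum>(\<eta>, \<xi>)\<in>F. c \<eta> * d \<xi> * qshuffle_words \<eta> \<xi> (l # w))"
    unfolding left_quotient_def by (rule qshuffle_eq_sum[OF \<open>finite F\<close>]) (auto simp: F_def)
  also have "\<dots> = (\<Sum>q\<in>F. h q * (t1 q + t2 q - (\<Sum>p\<in>?D. t3 p q)))"
    by (intro sum.cong) (auto simp: h_def t1_def t2_def t3_def qshuffle_words_Cons split_def)
  also have "\<dots> = (\<Sum>q\<in>F. h q * t1 q) + (\<Sum>q\<in>F. h q * t2 q) - (\<Sum>q\<in>F. \<Sum>p\<in>?D. h q * t3 p q)"
    by (simp add: algebra_simps sum.distrib sum_subtractf sum_distrib_left)
  also have "(\<Sum>q\<in>F. \<Sum>p\<in>?D. h q * t3 p q) = (\<Sum>p\<in>?D. \<Sum>q\<in>F. h q * t3 p q)"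
    by (rule sum.swap)
  also have "(\<Sum>q\<in>F. h q * t1 q) = (\<Sum>q\<in>F1. h q * t1 q)"
    by (intro restrict t1) (auto simp: F_def)
  also have "\<dots> = qshuffle (left_quotient l c) d w"
    unfolding F1_def qshuffle_def
    by (subst sum.reindex)
      (auto simp: P_def h_def t1_def prefix_letter_def left_quotient_def inj_on_def intro!: sum.cong)
  also have "(\<Sum>q\<in>F. h q * t2 q) = (\<Sum>q\<in>F2. h q * t2 q)"
    by (intro restrict t2) (auto simp: F_def)
  also have "\<dots> = qshuffle c (left_quotient l d) w"
    unfolding F2_def qshuffle_def
    by (subst sum.reindex)
      (auto simp: P_def h_def t2_def prefix_letter_def left_quotient_def inj_on_def intro!: sum.cong)
  also have "(\<Sum>p\<in>?D. \<Sum>q\<in>F. h q * t3 p q)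
      = (\<Sum>(a, b)\<in>?D. qshuffle (left_quotient a c) (left_quotient b d) w)"
  proof (intro sum.cong refl, clarify)
    fix a b assume l: "l = bracket a b"
    have "F3 (a, b) \<subseteq> F" using l unfolding F_def by blast
    then have "(\<Sum>q\<in>F. h q * t3 (a, b) q) = (\<Sum>q\<in>F3 (a, b). h q * t3 (a, b) q)"
      by (intro restrict t3)
    also have "\<dots> = qshuffle (left_quotient a c) (left_quotient b d) w"
      unfolding F3_def qshuffle_def prod.case
      by (subst sum.reindex)
        (auto simp: P_def h_def t3_def prefix_letter_def left_quotient_def inj_on_def intro!: sum.cong)
    finally show "(\<Sum>q\<in>F. h q * t3 (a, b) q) = qshuffle (left_quotient a c) (left_quotient b d) w" .
  qed
  finally show "left_quotient l (qshuffle c d) w =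
     (qshuffle (left_quotient l c) d + qshuffle c (left_quotient l d)
      - (\<Sum>(a, b)\<in>?D. qshuffle (left_quotient a c) (left_quotient b d))) w"
    by (simp add: sum_series_apply split_def)
qed

text \<open>
  Each term of the quotient of \<open>b \<circledast> b'\<close> is a quasi-shuffle of an element of the span of \<open>B\<close> with
  one of the span of \<open>C\<close>.
\<close>

lemma recognizable_qshuffle:
  assumes "recognizable c" and "recognizable d"
  shows "recognizable (qshuffle c d)"
proof -
  obtain B C where B: "finite B" "shift_stable B" "c \<in> series.span B"
    and C: "finite C" "shift_stable C" "d \<in> series.span C"
    using assms unfolding recognizable_def by blast
  let ?S = "(\<lambda>(b, b'). qshuffle b b') ` (B \<times> C)"
  have mem: "qshuffle b b' \<in> series.span ?S" if "b \<in> series.span B" "b' \<in> series.span C" for b b'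
    by (intro bilinear_map_span that qshuffle_linear_left qshuffle_linear_right)
  have "left_quotient l (qshuffle b b') \<in> series.span ?S" if "b \<in> B" "b' \<in> C" for l b b'
  proof -
    have "left_quotient a b \<in> series.span B" "left_quotient a b' \<in> series.span C" for a
      using B C that by (auto simp: shift_stable_def)
    then show ?thesis
      unfolding left_quotient_qshuffle
      using that
      by (intro series.span_diff series.span_add series.span_sum)
        (auto intro!: mem intro: series.span_base)
  qed
  then have "shift_stable ?S" by (auto simp: shift_stable_def)
  moreover have "finite ?S" using B C by simp
  ultimately show ?thesis unfolding recognizable_def using mem[OF B(3) C(3)] by blast
qed


section \<open>The alphabet of a quasi-shuffle\<close>

lemma qshuffle_words_support:
  assumes "qshuffle_words \<eta> \<xi> w \<noteq> 0" and "\<eta> \<in> lists Xc" and "\<xi> \<in> lists Xd"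
  shows "w \<in> lists (Xc \<union> Xd \<union> bracket_set Xc Xd)"
  using assms
proof (induction \<eta> \<xi> arbitrary: w rule: qshuffle_words.induct)
  case (3 a \<eta> b \<xi>)
  from 3(4) obtain l w' where w: "w = l # w'"
    by (cases w) (auto simp: prefix_letter_def)
  have ab: "a \<in> Xc" "b \<in> Xd" "bracket a b \<in> bracket_set Xc Xd"
    using 3(5,6) by (auto simp: bracket_set_def)
  consider "l = a" "qshuffle_words \<eta> (b # \<xi>) w' \<noteq> 0"
    | "l = b" "qshuffle_words (a # \<eta>) \<xi> w' \<noteq> 0"
    | "l = bracket a b" "qshuffle_words \<eta> \<xi> w' \<noteq> 0"
    using 3(4) w by (fastforce simp: prefix_letter_def split: if_splits)
  then show ?case
  proof cases
    case 1
    then show ?thesis using 3(1)[of w'] 3(5,6) w ab by auto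
  next
    case 2
    then show ?thesis using 3(2)[of w'] 3(5,6) w ab by auto
  next
    case 3
    then show ?thesis using "3.IH"(3)[of w'] "3.prems"(2,3) w ab by auto
  qed
qed (auto simp: word_series_def split: if_splits)

lemma series_over_qshuffle:
  assumes "c \<in> series_over Xc" and "d \<in> series_over Xd"
  shows "qshuffle c d \<in> series_over (Xc \<union> Xd \<union> bracket_set Xc Xd)"
proof (rule series_overI)
  fix w assume "qshuffle c d w \<noteq> 0"
  then obtain \<eta> \<xi> where "qshuffle_words \<eta> \<xi> w \<noteq> 0" "c \<eta> \<noteq> 0" "d \<xi> \<noteq> 0"
    unfolding qshuffle_def by (elim sum.not_neutral_contains_not_neutral) auto
  then show "w \<in> lists (Xc \<union> Xd \<union> bracket_set Xc Xd)"
    using assms by (metis qshuffle_words_support series_overD)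
qed

lemma finite_bracket_set:
  assumes "finite A" and "finite B"
  shows "finite (bracket_set A B)"
proof -
  have "bracket_set A B = (\<lambda>(x, y). bracket x y) ` (A \<times> B)"
    by (auto simp: bracket_set_def)
  then show ?thesis using assms by simp
qed

theorem theorem12:
  fixes c d :: "('x :: finite) letter series"
    and Xc Xd :: "'x letter set"
  assumes "rational_over Xc c"
    and "rational_over Xd d"
  shows "rational_over (Xc \<union> Xd \<union> bracket_set Xc Xd) (qshuffle c d)"
proof -
  have "recognizable c" "recognizable d"
    using assms by (auto simp: rational_over_def intro: rational_imp_recognizable)
  then have "recognizable (qshuffle c d)" by (rule recognizable_qshuffle)
  moreover have "finite (Xc \<union> Xd \<union> bracket_set Xc Xd)"
    using assms by (simp add: rational_over_def finite_bracket_set)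
  moreover have "qshuffle c d \<in> series_over (Xc \<union> Xd \<union> bracket_set Xc Xd)"
    using assms by (simp add: rational_over_def series_over_qshuffle)
  ultimately show ?thesis
    by (simp add: rational_over_def recognizable_imp_rational)
qed

end
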